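(* Let $n\in\mathbb{N}$, $n\ge 2$. For all $a,b\in\mathbb{R}^n$ the following generalized Room identity holds: $$M_n(a)^T M_n(b)=\langle b,a\rangle\, I_n-b\otimes a\in\mathbb{R}^{n\times n},$$ and conversely $$b\otimes a=\frac{\operatorname{tr}\big(M_n(a)^TM_n(b)\big)}{n-1}\, I_n-M_n(a)^TM_n(b).$$
   Context: Vectors are real column vectors, $\langle\cdot,\cdot\rangle$ is the Euclidean scalar product, $a\otimes b=ab^T$ is the dyadic product, $I_n$ is the $n\times n$ identity matrix, and $\operatorname{tr}$ is the trace. For $a\in\mathbb{R}^n$ write $a=(\overline a,\alpha_n)^T$ with $\overline a\in\mathbb{R}^{n-1}$, and similarly for $b$. The generalized cross product $\times_n:\mathbb{R}^n\times\mathbb{R}^n\to\mathbb{R}^{n(n-1)/2}$ is defined inductively for $n\ge2$ by $$\begin{pmatrix}\alpha_1\\ \alpha_2\end{pmatrix}\times_2\begin{pmatrix}\beta_1\\ \beta_2\end{pmatrix}=\alpha_1\beta_2-\alpha_2\beta_1,\qquad a\times_n b=\begin{pmatrix}\overline a\times_{n-1}\overline b\\ \beta_n\overline a-\alpha_n\overline b\end{pmatrix}.$$ Equivalently, its entries are $\alpha_i\beta_j-\alpha_j\beta_i$ for $i<j$, listed in the order $(i,j)=(1,2),(1,3),(2,3),(1,4),(2,4),(3,4),\ldots$. For $a\in\mathbb{R}^n$, $M_n(a)\in\mathbb{R}^{\frac{n(n-1)}{2}\times n}$ denotes the unique matrix with $M_n(a)\,b=a\times_n b$ for all $b\in\mathbb{R}^n$.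 *)

theory Defs
  imports Complex_Main "Jordan_Normal_Form.Matrix"
begin

text \<open>
  Vectors in \<open>\<real>\<^sup>n\<close> are elements of \<open>carrier_vec n\<close>, indexed from \<open>0\<close>. The values of
  \<open>gcross\<close> for \<open>n < 2\<close> carry no meaning.
\<close>

fun gcross :: "nat \<Rightarrow> real vec \<Rightarrow> real vec \<Rightarrow> real vec" where
  "gcross 0 a b = 0\<^sub>v 0"
| "gcross (Suc 0) a b = 0\<^sub>v 0"
| "gcross (Suc (Suc 0)) a b = vec_of_list [a $ 0 * b $ 1 - a $ 1 * b $ 0]"
| "gcross (Suc (Suc (Suc m))) a b =
     (let n = Suc (Suc m); a' = vec_first a n; b' = vec_first b n
      in gcross n a' b' @\<^sub>v ((b $ n) \<cdot>\<^sub>v a' - (a $ n) \<cdot>\<^sub>v b'))"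

definition gcross_mat :: "nat \<Rightarrow> real vec \<Rightarrow> real mat" where
  "gcross_mat n a = (THE M. M \<in> carrier_mat (n * (n - 1) div 2) n \<and>
     (\<forall>b \<in> carrier_vec n. M *\<^sub>v b = gcross n a b))"

definition dyadic :: "real vec \<Rightarrow> real vec \<Rightarrow> real mat" (infixl \<open>\<otimes>\<^sub>d\<close> 70) where
  "a \<otimes>\<^sub>d b = mat_of_cols (dim_vec a) [a] * (mat_of_cols (dim_vec b) [b])\<^sup>T"

definition mat_trace :: "real mat \<Rightarrow> real" where
  "mat_trace A = (\<Sum>i < dim_row A. A $$ (i, i))"

lemma gcross_mat_exists:
  assumes "n \<ge> 2"
  shows "\<exists>M \<in> carrier_mat (n * (n - 1) div 2) n.
           \<forall>b \<in> carrier_vec n. M *\<^sub>v b = gcross n a b"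
  using assms
proof (induction n arbitrary: a rule: nat_induct_at_least)
  case base
  define M where "M = mat_of_rows_list 2 [[- a $ 1, a $ 0]]"
  have "M \<in> carrier_mat 1 2"
    by (auto simp: M_def mat_of_rows_list_def)
  moreover have "M *\<^sub>v b = gcross 2 a b" if "b \<in> carrier_vec 2" for b
    using that
    by (intro eq_vecI)
      (auto simp: M_def mat_of_rows_list_def scalar_prod_def numeral_2_eq_2)
  ultimately show ?case by auto
next
  case (Suc n)
  define N where "N = n * (n - 1) div 2"
  define a' where "a' = vec_first a n"
  obtain M where M: "M \<in> carrier_mat N n"
    "\<And>b. b \<in> carrier_vec n \<Longrightarrow> M *\<^sub>v b = gcross n a' b"
    using Suc.IH[of a'] by (auto simp: N_def)
  define M' where "M' = four_block_mat M (0\<^sub>m N 1)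
    ((- (a $ n)) \<cdot>\<^sub>m 1\<^sub>m n) (mat_of_cols n [a'])"
  have N: "Suc n * (Suc n - 1) div 2 = N + n"
    using Suc.hyps by (cases n) (auto simp: N_def)
  have "M' \<in> carrier_mat (N + n) (Suc n)"
    using M(1) by (auto simp: M'_def)
  moreover have "M' *\<^sub>v b = gcross (Suc n) a b" if b: "b \<in> carrier_vec (Suc n)" for b
  proof -
    obtain m where m: "n = Suc (Suc m)"
      using Suc.hyps by (metis Suc_le_D numeral_2_eq_2 Suc_le_mono)
    define b' where "b' = vec_first b n"
    have b'c: "b' \<in> carrier_vec n" by (simp add: b'_def)
    have split: "b = b' @\<^sub>v vec_of_list [b $ n]"
      using b by (intro eq_vecI) (auto simp: b'_def vec_first_def less_Suc_eq)
    have "M' *\<^sub>v b = (M *\<^sub>v b' + 0\<^sub>m N 1 *\<^sub>v vec_of_list [b $ n]) @\<^sub>v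
       (((- (a $ n)) \<cdot>\<^sub>m 1\<^sub>m n) *\<^sub>v b' + mat_of_cols n [a'] *\<^sub>v vec_of_list [b $ n])"
      unfolding M'_def
      by (subst split, rule four_block_mat_mult_vec[OF M(1) _ _ _ b'c]) (auto intro!: carrier_vecI)
    also have "M *\<^sub>v b' + 0\<^sub>m N 1 *\<^sub>v vec_of_list [b $ n] = gcross n a' b'"
    proof -
      have "M *\<^sub>v b' \<in> carrier_vec N" using M(1) b'c by auto
      moreover have "0\<^sub>m N 1 *\<^sub>v vec_of_list [b $ n] = 0\<^sub>v N"
        by (intro eq_vecI) (auto simp: scalar_prod_def)
      ultimately show ?thesis using M(2)[OF b'c] by simp
    qed
    also have "((- (a $ n)) \<cdot>\<^sub>m 1\<^sub>m n) *\<^sub>v b' + mat_of_cols n [a'] *\<^sub>v vec_of_list [b $ n]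
       = (b $ n) \<cdot>\<^sub>v a' - (a $ n) \<cdot>\<^sub>v b'"
    proof -
      have "((- (a $ n)) \<cdot>\<^sub>m 1\<^sub>m n) *\<^sub>v b' = (- (a $ n)) \<cdot>\<^sub>v b'"
        using b'c by (intro eq_vecI) auto
      moreover have "mat_of_cols n [a'] *\<^sub>v vec_of_list [b $ n] = (b $ n) \<cdot>\<^sub>v a'"
        by (intro eq_vecI) (auto simp: a'_def scalar_prod_def mat_of_cols_def)
      ultimately show ?thesis
        using b'c by (intro eq_vecI) (auto simp: a'_def)
    qed
    finally show ?thesis
      by (simp add: m a'_def b'_def Let_def)
  qed
  ultimately show ?case unfolding N by blast
qed

lemma gcross_mat_ex1:
  assumes "n \<ge> 2"
  shows "\<exists>!M. M \<in> carrier_mat (n * (n - 1) div 2) n \<and>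
           (\<forall>b \<in> carrier_vec n. M *\<^sub>v b = gcross n a b)"
proof -
  have "A = B" if A: "A \<in> carrier_mat k n" and B: "B \<in> carrier_mat k n"
    and eq: "\<And>b. b \<in> carrier_vec n \<Longrightarrow> A *\<^sub>v b = B *\<^sub>v b" for A B :: "real mat" and k
  proof (rule mat_col_eqI)
    fix j assume "j < dim_col B"
    then have j: "j < n" using B by simp
    show "col A j = col B j"
    proof (rule eq_vecI)
      fix i assume "i < dim_vec (col B j)"
      then have i: "i < k" using B by simp
      have "(A *\<^sub>v unit_vec n j) $ i = (B *\<^sub>v unit_vec n j) $ i"
        using eq[of "unit_vec n j"] by simp
      then show "col A j $ i = col B j $ i"
        using A B i j by simp
    qed (use A B in auto)
  qed (use A B in auto)
  then show ?thesis using gcross_mat_exists[OF assms, of a] by (metis (no_types, lifting))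
qed

end

theory Submission
  imports Defs
begin

text \<open>
  The Room identity is the matrix form of the generalized Lagrange identity
  \<open>\<langle>a \<times> u, b \<times> v\<rangle> = \<langle>a, b\<rangle> \<langle>u, v\<rangle> - \<langle>a, v\<rangle> \<langle>u, b\<rangle>\<close> (lemma \<open>gcross_scalar_prod\<close>). Indeed the
  \<open>i\<close>-th column of \<open>M(a)\<close> is \<open>a \<times> e\<^sub>i\<close>, so entry \<open>(i, j)\<close> of \<open>M(a)\<^sup>T M(b)\<close> is
  \<open>\<langle>a \<times> e\<^sub>i, b \<times> e\<^sub>j\<rangle>\<close>, which the Lagrange identity evaluates to
  \<open>\<langle>a, b\<rangle> \<delta>\<^sub>i\<^sub>j - a\<^sub>j b\<^sub>i\<close>. The Lagrange identity itself follows the recursion of the cross product: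
  appending one coordinate changes both sides by the same amount.

  For the converse, \<open>b \<otimes> a\<close> has trace \<open>\<langle>b, a\<rangle>\<close>, so taking traces in the Room identity gives
  \<open>tr (M(a)\<^sup>T M(b)) = (n - 1) \<langle>b, a\<rangle>\<close>. Hence the product \<open>M(a)\<^sup>T M(b)\<close> determines the coefficient
  \<open>\<langle>b, a\<rangle>\<close>, and the identity can be solved for \<open>b \<otimes> a\<close>.
\<close>

lemma gcross_carrier:
  assumes "n \<ge> 2"
  shows "gcross n a b \<in> carrier_vec (n * (n - 1) div 2)"
  using assms
proof (induction n arbitrary: a b rule: nat_induct_at_least)
  case base
  then show ?case by (auto simp: numeral_2_eq_2 intro!: carrier_vecI)
next
  case (Suc n)
  obtain m where m: "n = Suc (Suc m)"
    using Suc.hyps by (metis Suc_le_D numeral_2_eq_2 Suc_le_mono)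
  have "gcross (Suc n) a b \<in> carrier_vec (n * (n - 1) div 2 + n)"
    using Suc.IH[of "vec_first a n" "vec_first b n"] by (auto simp: m Let_def intro!: carrier_vecI)
  moreover have "Suc n * (Suc n - 1) div 2 = n * (n - 1) div 2 + n"
    by (simp add: m)
  ultimately show ?case by simp
qed

lemma scalar_prod_snoc:
  fixes a b :: "real vec"
  assumes "a \<in> carrier_vec (Suc n)" and "b \<in> carrier_vec (Suc n)"
  shows "a \<bullet> b = vec_first a n \<bullet> vec_first b n + a $ n * b $ n"
  using assms by (simp add: scalar_prod_def vec_first_def)

text \<open>
  The appended blocks contribute \<open>\<langle>u\<^sub>n a' - a\<^sub>n u', v\<^sub>n b' - b\<^sub>n v'\<rangle>\<close>; its four terms are the mixed
  terms in the expansion of the right-hand side, where the two products of four last entries cancel.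
\<close>
lemma gcross_scalar_prod:
  assumes "n \<ge> 2"
    and "a \<in> carrier_vec n" "b \<in> carrier_vec n" "u \<in> carrier_vec n" "v \<in> carrier_vec n"
  shows "gcross n a u \<bullet> gcross n b v = (a \<bullet> b) * (u \<bullet> v) - (a \<bullet> v) * (u \<bullet> b)"
  using assms
proof (induction n arbitrary: a b u v rule: nat_induct_at_least)
  case base
  then show ?case
    by (simp add: numeral_2_eq_2 scalar_prod_def algebra_simps)
next
  case (Suc n)
  obtain m where m: "n = Suc (Suc m)"
    using Suc.hyps by (metis Suc_le_D numeral_2_eq_2 Suc_le_mono)
  define t where "t x = vec_first x n" for x :: "real vec"
  have t: "t x \<in> carrier_vec n" for x by (simp add: t_def)
  define w where "w x y = (y $ n) \<cdot>\<^sub>v t x - (x $ n) \<cdot>\<^sub>v t y" for x y :: "real vec"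
  have w: "w x y \<in> carrier_vec n" for x y by (simp add: w_def t)
  have step: "gcross (Suc n) x y = gcross n (t x) (t y) @\<^sub>v w x y" for x y
    by (simp add: m t_def w_def Let_def)
  have IH: "gcross n (t a) (t u) \<bullet> gcross n (t b) (t v)
      = (t a \<bullet> t b) * (t u \<bullet> t v) - (t a \<bullet> t v) * (t u \<bullet> t b)"
    by (intro Suc.IH t)
  have "w a u \<bullet> w b v = u $ n * v $ n * (t a \<bullet> t b) - u $ n * b $ n * (t a \<bullet> t v)
      - a $ n * v $ n * (t u \<bullet> t b) + a $ n * b $ n * (t u \<bullet> t v)"
    using t[of a] t[of b] t[of u] t[of v] unfolding w_def
    by (simp add: scalar_prod_minus_distrib[of _ n] minus_scalar_prod_distrib[of _ n]
        smult_scalar_prod_distrib[of _ n] scalar_prod_smult_distrib[of _ n] algebra_simps)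
  moreover have "gcross (Suc n) a u \<bullet> gcross (Suc n) b v
      = gcross n (t a) (t u) \<bullet> gcross n (t b) (t v) + w a u \<bullet> w b v"
    unfolding step by (rule scalar_prod_append[OF gcross_carrier w gcross_carrier w]) (fact Suc.hyps)+
  moreover have "x \<bullet> y = t x \<bullet> t y + x $ n * y $ n"
    if "x \<in> carrier_vec (Suc n)" "y \<in> carrier_vec (Suc n)" for x y
    using scalar_prod_snoc[OF that] by (simp add: t_def)
  ultimately show ?case
    using Suc.prems by (simp add: IH algebra_simps)
qed

lemma
  assumes "n \<ge> 2"
  shows gcross_mat_carrier: "gcross_mat n a \<in> carrier_mat (n * (n - 1) div 2) n"
    and gcross_mat_mult_vec: "b \<in> carrier_vec n \<Longrightarrow> gcross_mat n a *\<^sub>v b = gcross n a b"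
  using theI'[OF gcross_mat_ex1[OF assms, of a]] unfolding gcross_mat_def by blast+

lemma col_gcross_mat:
  assumes "n \<ge> 2" and "i < n"
  shows "col (gcross_mat n a) i = gcross n a (unit_vec n i)"
proof -
  have "gcross_mat n a *\<^sub>v unit_vec n i = col (gcross_mat n a) i"
    using gcross_mat_carrier[OF assms(1), of a] assms(2)
    by (intro eq_vecI) auto
  then show ?thesis
    using gcross_mat_mult_vec[OF assms(1), of "unit_vec n i" a] by simp
qed

lemma index_dyadic:
  assumes "i < dim_vec a" and "j < dim_vec b"
  shows "(a \<otimes>\<^sub>d b) $$ (i, j) = a $ i * b $ j"
  using assms by (simp add: dyadic_def scalar_prod_def mat_of_cols_def)

lemma dyadic_carrier: "a \<otimes>\<^sub>d b \<in> carrier_mat (dim_vec a) (dim_vec b)"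
  by (simp add: dyadic_def carrier_matI)

lemma room_identity:
  assumes n: "n \<ge> 2" and a: "a \<in> carrier_vec n" and b: "b \<in> carrier_vec n"
  shows "(gcross_mat n a)\<^sup>T * gcross_mat n b = (b \<bullet> a) \<cdot>\<^sub>m 1\<^sub>m n - b \<otimes>\<^sub>d a"
proof (rule eq_matI)
  fix i j
  assume "i < dim_row ((b \<bullet> a) \<cdot>\<^sub>m 1\<^sub>m n - b \<otimes>\<^sub>d a)" "j < dim_col ((b \<bullet> a) \<cdot>\<^sub>m 1\<^sub>m n - b \<otimes>\<^sub>d a)"
  then have ij: "i < n" "j < n" using dyadic_carrier[of b a] a b by auto
  have "((gcross_mat n a)\<^sup>T * gcross_mat n b) $$ (i, j)
      = gcross n a (unit_vec n i) \<bullet> gcross n b (unit_vec n j)"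
    using ij gcross_mat_carrier[OF n, of a] gcross_mat_carrier[OF n, of b]
    by (simp add: col_gcross_mat[OF n])
  also have "\<dots> = (a \<bullet> b) * (unit_vec n i \<bullet> unit_vec n j) - (a \<bullet> unit_vec n j) * (unit_vec n i \<bullet> b)"
    by (intro gcross_scalar_prod n a b) auto
  also have "\<dots> = (b \<bullet> a) * (if i = j then 1 else 0) - b $ i * a $ j"
    using ij a b by (simp add: comm_scalar_prod[OF a b])
  also have "\<dots> = ((b \<bullet> a) \<cdot>\<^sub>m 1\<^sub>m n - b \<otimes>\<^sub>d a) $$ (i, j)"
    using ij a b dyadic_carrier[of b a] by (simp add: index_dyadic)
  finally show "((gcross_mat n a)\<^sup>T * gcross_mat n b) $$ (i, j)
      = ((b \<bullet> a) \<cdot>\<^sub>m 1\<^sub>m n - b \<otimes>\<^sub>d a) $$ (i, j)" .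
qed (use a b dyadic_carrier[of b a] gcross_mat_carrier[OF n] in auto)

lemma mat_trace_room:
  assumes a: "a \<in> carrier_vec n" and b: "b \<in> carrier_vec n"
  shows "mat_trace ((b \<bullet> a) \<cdot>\<^sub>m 1\<^sub>m n - b \<otimes>\<^sub>d a) = (real n - 1) * (b \<bullet> a)"
proof -
  have "mat_trace ((b \<bullet> a) \<cdot>\<^sub>m 1\<^sub>m n - b \<otimes>\<^sub>d a) = (\<Sum>i<n. b \<bullet> a - b $ i * a $ i)"
    using a b dyadic_carrier[of b a] by (simp add: mat_trace_def index_dyadic)
  also have "\<dots> = real n * (b \<bullet> a) - b \<bullet> a"
    using a by (simp add: sum_subtractf scalar_prod_def atLeast0LessThan)
  finally show ?thesis by (simp add: algebra_simps)
qed

theorem mainTheorem3: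
  fixes n :: nat and a b :: "real vec"
  assumes "n \<ge> 2"
    and "a \<in> carrier_vec n" and "b \<in> carrier_vec n"
  shows "(gcross_mat n a)\<^sup>T * gcross_mat n b \<in> carrier_mat n n
    \<and> (gcross_mat n a)\<^sup>T * gcross_mat n b = (b \<bullet> a) \<cdot>\<^sub>m 1\<^sub>m n - b \<otimes>\<^sub>d a
    \<and> b \<otimes>\<^sub>d a =
        (mat_trace ((gcross_mat n a)\<^sup>T * gcross_mat n b) / (real n - 1)) \<cdot>\<^sub>m 1\<^sub>m n
        - (gcross_mat n a)\<^sup>T * gcross_mat n b"
proof -
  have D: "b \<otimes>\<^sub>d a \<in> carrier_mat n n"
    using dyadic_carrier[of b a] assms by simp
  have "mat_trace ((b \<bullet> a) \<cdot>\<^sub>m 1\<^sub>m n - b \<otimes>\<^sub>d a) / (real n - 1) = b \<bullet> a"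
    using assms by (simp add: mat_trace_room)
  moreover have "b \<otimes>\<^sub>d a = c \<cdot>\<^sub>m 1\<^sub>m n - (c \<cdot>\<^sub>m 1\<^sub>m n - b \<otimes>\<^sub>d a)" for c
    using D by (intro eq_matI) auto
  ultimately show ?thesis
    using minus_carrier_mat[OF D] by (simp add: room_identity[OF assms])
qed

end
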